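(* For every real $k>0$ and every real $x$, $$H_k(x+k)=x\,H_k(x)+\frac{1}{\Gamma_k(k-x)}.$$
   Context: For $k>0$ and $x>0$, $\Gamma_k(x)=\int_0^\infty t^{x-1}e^{-t^k/k}\,dt=k^{x/k-1}\Gamma(x/k)$; the last expression extends $\Gamma_k$ meromorphically, with $1/\Gamma_k$ entire (equal to $0$ at the poles of $\Gamma_k$). Put $\psi_k=\Gamma_k'/\Gamma_k$. The Hadamard $k$-gamma function is defined for real $x$ by $$H_k(x)=\frac{\psi_k\left(k-\frac x2\right)-\psi_k\left(\frac k2-\frac x2\right)}{2\,\Gamma_k(k-x)},$$ where at the points $x=k,2k,3k,\dots$ (removable singularities) the value is defined by continuity. *)

theory Defs
  imports "HOL-Analysis.Analysis"
begin

(* The meromorphic extension of Gamma_k, restricted to the real line.  The library's Gamma is 0 at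
   its poles, hence so is Gamma_k (see Gamma_k_eq_0_iff), and "1 / Gamma_k k x" is therefore the
   value at x of the entire function 1/Gamma_k for every real x, poles of Gamma_k included. *)
definition Gamma_k :: "real \<Rightarrow> real \<Rightarrow> real" where
  "Gamma_k k x = k powr (x / k - 1) * Gamma (x / k)"

definition psi_k :: "real \<Rightarrow> real \<Rightarrow> real" where
  "psi_k k x = deriv (Gamma_k k) x / Gamma_k k x"

(* At x = k, 2k, 3k, ... one of the two psi_k-terms has a pole, and the value is the limit. *)
definition Hadamard_k :: "real \<Rightarrow> real \<Rightarrow> real" where
  "Hadamard_k k x =
     (let h = (\<lambda>y. (psi_k k (k - y / 2) - psi_k k (k / 2 - y / 2)) / (2 * Gamma_k k (k - y)))
      in if \<exists>n::nat. n > 0 \<and> x = real n * k then Lim (at x) h else h x)"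

lemma Gamma_k_eq_0_iff:
  assumes "k > 0"
  shows "Gamma_k k x = 0 \<longleftrightarrow> (\<exists>n::nat. x = - (real n * k))"
proof -
  have "x / k = - real n \<longleftrightarrow> x = - (real n * k)" for n
    using assms by (simp add: field_simps)
  then show ?thesis
    using assms by (auto simp: Gamma_k_def Gamma_eq_zero_iff elim!: nonpos_Ints_cases')
qed

(* Agreement with the integral that defines Gamma_k on the positive half-line. *)
lemma Gamma_k_has_integral:
  assumes k: "k > 0" and x: "x > 0"
  shows "((\<lambda>t. t powr (x - 1) * exp (- (t powr k / k))) has_integral Gamma_k k x) {0<..}"
proof -
  define g where "g = (\<lambda>t. t powr k / k)"
  define f where "f = (\<lambda>t. t powr (x / k - 1) / exp t)"
  have img: "g ` {0<..} = {0<..}"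
  proof
    show "g ` {0<..} \<subseteq> {0<..}" using k by (auto simp: g_def)
    show "{0<..} \<subseteq> g ` {0<..}"
    proof
      fix u :: real assume u: "u \<in> {0<..}"
      have "g ((k * u) powr (1 / k)) = u" using k u by (simp add: g_def powr_powr)
      moreover have "(k * u) powr (1 / k) \<in> {0<..}" using k u by simp
      ultimately show "u \<in> g ` {0<..}" by (metis imageI)
    qed
  qed
  have inj: "inj_on g {0<..}"
  proof (rule inj_onI)
    fix s t assume "s \<in> {0<..}" "t \<in> {0<..}" "g s = g t"
    then have "0 < s" "0 < t" "s powr k = t powr k" using k by (auto simp: g_def)
    then have "(s powr k) powr (1 / k) = (t powr k) powr (1 / k)" by simp
    then show "s = t" using k \<open>0 < s\<close> \<open>0 < t\<close> by (simp add: powr_powr)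
  qed
  have der: "(g has_field_derivative (t powr (k - 1))) (at t within {0<..})" if "t \<in> {0<..}" for t
    using that k unfolding g_def
    by (auto intro!: derivative_eq_intros simp: field_simps powr_diff)
  have f_int: "(f has_integral Gamma (x / k)) {0<..}"
  proof -
    have "(f has_integral Gamma (x / k)) {0..}"
      unfolding f_def using Gamma_integral_real[of "x / k"] k x by simp
    moreover have "(f has_integral Gamma (x / k)) {0..} \<longleftrightarrow> (f has_integral Gamma (x / k)) {0<..}"
      by (rule has_integral_spike_set_eq; rule negligible_subset[of "{0}"]) auto
    ultimately show ?thesis by simp
  qed
  then have f_abs: "f absolutely_integrable_on {0<..}"
    by (intro nonnegative_absolutely_integrable_1) (auto simp: f_def integrable_on_def)
  have *: "(\<lambda>t. \<bar>t powr (k - 1)\<bar> * f (g t)) absolutely_integrable_on {0<..} \<and>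
        integral {0<..} (\<lambda>t. \<bar>t powr (k - 1)\<bar> * f (g t)) = Gamma (x / k)"
    using f_abs integral_unique[OF f_int]
    by (subst has_absolute_integral_change_of_variables_1'[OF _ der inj]) (auto simp: img)
  have "((\<lambda>t. \<bar>t powr (k - 1)\<bar> * f (g t)) has_integral Gamma (x / k)) {0<..}"
    using integrable_integral[OF absolutely_integrable_on_def[THEN iffD1, THEN conjunct1, OF *[THEN conjunct1]]] *
    by simp
  then have "((\<lambda>t. k powr (x / k - 1) * (\<bar>t powr (k - 1)\<bar> * f (g t))) has_integral Gamma_k k x) {0<..}"
    unfolding Gamma_k_def by (rule has_integral_mult_right)
  moreover have "k powr (x / k - 1) * (\<bar>t powr (k - 1)\<bar> * f (g t)) =
      t powr (x - 1) * exp (- (t powr k / k))" if "t \<in> {0<..}" for t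
  proof -
    have "k * (x / k - 1) = x - k" using k by (simp add: field_simps)
    then have "g t powr (x / k - 1) = t powr (x - k) / k powr (x / k - 1)"
      using that k by (simp add: g_def powr_divide powr_powr)
    moreover have "t powr (k - 1) * t powr (x - k) = t powr (x - 1)"
      by (simp add: powr_add[symmetric])
    ultimately show ?thesis
      using k by (simp add: f_def g_def exp_minus field_simps)
  qed
  ultimately show ?thesis by (rule has_integral_eq[rotated])
qed

end

theory Submission
  imports Defs
begin

text \<open>
  With \<open>u = x / k\<close>, the quotient defining \<open>H\<^sub>k\<close> is a multiple of
  \<open>(\<psi>(1 - u/2) - \<psi>(1/2 - u/2)) / \<Gamma>(1 - u)\<close>, so off the multiples of \<open>k\<close> the functional equation
  follows from \<open>\<psi>(z + 1) = \<psi>(z) + 1/z\<close> and \<open>\<Gamma>(z + 1) = z \<Gamma>(z)\<close>.  It extends to all \<open>x\<close> by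
  passing to the limit.  That the limits at \<open>k, 2k, 3k, \<dots>\<close> exist needs no analysis of the poles:
  the quotient is continuous at \<open>0\<close>, and the functional equation on a punctured neighbourhood of
  \<open>n k\<close> carries a limit at \<open>n k\<close> over to \<open>(n + 1) k\<close>.
\<close>

text \<open>The local \<open>h\<close> of \<open>Hadamard_k\<close>, named so that its limits can be
  studied. Its values at the positive multiples of \<open>k\<close> come only from the conventions
  for poles and division by zero; a limit there ignores them.\<close>

definition hadamard_quotient :: "real \<Rightarrow> real \<Rightarrow> real" where
  "hadamard_quotient k y =
     (psi_k k (k - y / 2) - psi_k k (k / 2 - y / 2)) / (2 * Gamma_k k (k - y))"

lemma Hadamard_k_altdef:
  "Hadamard_k k x =
     (if \<exists>n::nat. n > 0 \<and> x = real n * k then Lim (at x) (hadamard_quotient k)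
      else hadamard_quotient k x)"
  unfolding Hadamard_k_def Let_def hadamard_quotient_def[abs_def] by (rule refl)

lemma psi_k_eq_Digamma:
  assumes k: "k > 0" and z: "z / k \<notin> \<int>\<^sub>\<le>\<^sub>0"
  shows "psi_k k z = (ln k + Digamma (z / k)) / k"
proof -
  have "(Gamma_k k has_field_derivative Gamma_k k z * ((ln k + Digamma (z / k)) / k)) (at z)"
    unfolding Gamma_k_def using k z
    by (auto intro!: derivative_eq_intros simp: field_simps)
  then have "deriv (Gamma_k k) z = Gamma_k k z * ((ln k + Digamma (z / k)) / k)"
    by (rule DERIV_imp_deriv)
  moreover have "Gamma_k k z \<noteq> 0"
    using k z by (simp add: Gamma_k_def Gamma_eq_zero_iff)
  ultimately show ?thesis
    by (simp add: psi_k_def)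
qed

text \<open>Since \<open>rGamma\<close> is entire, this form makes the continuity of the reciprocal
  visible at every \<open>x\<close>; at the poles both sides are 0.\<close>

lemma inverse_Gamma_k:
  assumes "k > 0"
  shows "1 / Gamma_k k (k - x) = k powr (x / k) * rGamma (1 - x / k)"
proof -
  have "(k - x) / k = 1 - x / k" "(k - x) / k - 1 = - (x / k)"
    using assms by (simp_all add: diff_divide_distrib)
  then have "Gamma_k k (k - x) = inverse (k powr (x / k)) * Gamma (1 - x / k)"
    unfolding Gamma_k_def by (simp only: powr_minus)
  then show ?thesis
    by (simp add: rGamma_inverse_Gamma divide_inverse)
qed

text \<open>The \<open>ln k\<close> terms of the two \<open>psi_k\<close> values cancel. The first
  \<open>Digamma\<close> argument meets a pole exactly at the positive even multiples of
  \<open>k\<close>, the second at the odd ones.\<close>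

lemma hadamard_quotient_eq:
  assumes k: "k > 0" and x: "\<not> (\<exists>n::nat. n > 0 \<and> x = real n * k)"
  shows "hadamard_quotient k x =
    (Digamma (1 - x / k / 2) - Digamma (1 / 2 - x / k / 2)) / (2 * k) *
      (k powr (x / k) * rGamma (1 - x / k))"
    and "1 - x / k / 2 \<notin> \<int>\<^sub>\<le>\<^sub>0" and "1 / 2 - x / k / 2 \<notin> \<int>\<^sub>\<le>\<^sub>0"
proof -
  show 1: "1 - x / k / 2 \<notin> \<int>\<^sub>\<le>\<^sub>0"
  proof
    assume "1 - x / k / 2 \<in> \<int>\<^sub>\<le>\<^sub>0"
    then obtain n where "1 - x / k / 2 = - real n" by (auto elim!: nonpos_Ints_cases')
    then have "x = real (2 * n + 2) * k" using k by (simp add: field_simps)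
    then show False using x by (metis add_gr_0 zero_less_numeral)
  qed
  show 2: "1 / 2 - x / k / 2 \<notin> \<int>\<^sub>\<le>\<^sub>0"
  proof
    assume "1 / 2 - x / k / 2 \<in> \<int>\<^sub>\<le>\<^sub>0"
    then obtain n where "1 / 2 - x / k / 2 = - real n" by (auto elim!: nonpos_Ints_cases')
    then have "x = real (2 * n + 1) * k" using k by (simp add: field_simps)
    then show False using x by (metis add_gr_0 zero_less_one)
  qed
  have args: "(k - x / 2) / k = 1 - x / k / 2" "(k / 2 - x / 2) / k = 1 / 2 - x / k / 2"
    using k by (simp_all add: field_simps)
  have psi: "psi_k k (k - x / 2) = (ln k + Digamma (1 - x / k / 2)) / k"
      "psi_k k (k / 2 - x / 2) = (ln k + Digamma (1 / 2 - x / k / 2)) / k"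
    using psi_k_eq_Digamma[OF k, of "k - x / 2"] psi_k_eq_Digamma[OF k, of "k / 2 - x / 2"] 1 2
    unfolding args by blast+
  have "hadamard_quotient k x =
      (psi_k k (k - x / 2) - psi_k k (k / 2 - x / 2)) / 2 * (1 / Gamma_k k (k - x))"
    by (simp add: hadamard_quotient_def)
  also have "(psi_k k (k - x / 2) - psi_k k (k / 2 - x / 2)) / 2 =
      (Digamma (1 - x / k / 2) - Digamma (1 / 2 - x / k / 2)) / (2 * k)"
    unfolding psi using k by (simp add: divide_simps)
  finally show "hadamard_quotient k x =
    (Digamma (1 - x / k / 2) - Digamma (1 / 2 - x / k / 2)) / (2 * k) *
      (k powr (x / k) * rGamma (1 - x / k))"
    by (simp only: inverse_Gamma_k[OF k])
qed

text \<open>Raising \<open>u\<close> by 1 interchanges the two \<open>Digamma\<close> terms up to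
  one recurrence step, so the difference \<open>D\<close> changes sign and loses
  \<open>2 / u\<close>. The factor \<open>- u\<close> from \<open>rGamma\<close> restores the sign
  and turns \<open>2 / u\<close> into the extra summand.\<close>

lemma hadamard_quotient_plus:
  assumes k: "k > 0" and x: "x / k \<notin> \<int>"
  shows "hadamard_quotient k (x + k) = x * hadamard_quotient k x + 1 / Gamma_k k (k - x)"
proof -
  define u where "u = x / k"
  define D where "D = (\<lambda>v::real. Digamma (1 - v / 2) - Digamma (1 / 2 - v / 2))"
  have xu: "x = u * k" and xk: "(x + k) / k = u + 1"
    using k by (simp_all add: u_def field_simps)
  have u: "u \<notin> \<int>" "u \<noteq> 0" using x by (auto simp: u_def)
  have nx: "\<not> (\<exists>n::nat. n > 0 \<and> x = real n * k)"
    using x k by auto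
  have "\<not> (\<exists>n::nat. n > 0 \<and> x + k = real n * k)"
  proof
    assume "\<exists>n::nat. n > 0 \<and> x + k = real n * k"
    then obtain n where "x + k = real n * k" by auto
    then have "u = real n - 1" using k by (simp add: u_def field_simps)
    then show False using u by auto
  qed
  note eq = hadamard_quotient_eq(1)[OF k this] hadamard_quotient_eq(1)[OF k nx]
  have "Digamma (1 - u / 2) = Digamma (- u / 2) - 2 / u"
    using Digamma_plus1[of "- u / 2"] u by (simp add: field_simps)
  moreover have "1 - (u + 1) / 2 = 1 / 2 - u / 2" "1 / 2 - (u + 1) / 2 = - u / 2"
    by (simp_all add: field_simps)
  then have "D (u + 1) = Digamma (1 / 2 - u / 2) - Digamma (- u / 2)"
    by (simp only: D_def)
  ultimately have D: "D (u + 1) = - D u - 2 / u"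
    unfolding D_def by linarith
  have R: "rGamma (- u) = - u * rGamma (1 - u)"
    using rGamma_plus1[of "- u"] by simp
  have "hadamard_quotient k (x + k) = D (u + 1) / (2 * k) * (k powr (u + 1) * rGamma (- u))"
    using eq(1) by (simp add: xk D_def)
  also have "\<dots> = x * (D u / (2 * k) * (k powr u * rGamma (1 - u))) + k powr u * rGamma (1 - u)"
    unfolding D R xu powr_add using k u by (simp add: divide_simps) algebra
  also have "\<dots> = x * hadamard_quotient k x + 1 / Gamma_k k (k - x)"
    using eq(2) k by (simp add: inverse_Gamma_k D_def u_def)
  finally show ?thesis .
qed

lemma isCont_hadamard_quotient:
  assumes k: "k > 0" and x: "\<not> (\<exists>n::nat. n > 0 \<and> x = real n * k)"
  shows "isCont (hadamard_quotient k) x"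
proof -
  define f where "f = (\<lambda>y. (Digamma (1 - y / k / 2) - Digamma (1 / 2 - y / k / 2)) / (2 * k) *
    (k powr (y / k) * rGamma (1 - y / k)))"
  \<comment> \<open>The closed form holds only off the positive multiples of \<open>k\<close>. They
    form a closed set, as a preimage of the nonpositive integers, so it holds on a whole
    neighbourhood of \<open>x\<close>.\<close>
  have "open (- ((\<lambda>y. 1 - y / k) -` \<int>\<^sub>\<le>\<^sub>0))"
    by (intro open_Compl closed_vimage continuous_intros) (use k in auto)
  moreover have "- ((\<lambda>y. 1 - y / k) -` \<int>\<^sub>\<le>\<^sub>0) = {y. \<not> (\<exists>n::nat. n > 0 \<and> y = real n * k)}"
  proof -
    have "1 - y / k = - real m \<longleftrightarrow> y = real (Suc m) * k" for m y
      using k by (auto simp: field_simps)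
    then have "1 - y / k \<in> \<int>\<^sub>\<le>\<^sub>0 \<longleftrightarrow> (\<exists>m::nat. y = real (Suc m) * k)" for y
      by (metis minus_of_nat_in_nonpos_Ints nonpos_Ints_cases')
    then show ?thesis by (simp add: vimage_def set_eq_iff gr0_conv_Suc del: of_nat_Suc) blast
  qed
  ultimately have "open {y. \<not> (\<exists>n::nat. n > 0 \<and> y = real n * k)}"
    by simp
  then have "eventually (\<lambda>y. y \<in> {y. \<not> (\<exists>n::nat. n > 0 \<and> y = real n * k)}) (nhds x)"
    using x by (intro eventually_nhds_in_open) blast+
  then have "eventually (\<lambda>y. hadamard_quotient k y = f y) (nhds x)"
    unfolding f_def mem_Collect_eq by (rule eventually_mono) (rule hadamard_quotient_eq(1)[OF k])
  moreover have "isCont f x"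
    unfolding f_def using k hadamard_quotient_eq(2,3)[OF k x]
    by (auto intro!: continuous_intros)
  ultimately show ?thesis
    by (subst isCont_cong)
qed

lemma tendsto_hadamard_quotient_plus:
  assumes k: "k > 0" and L: "(hadamard_quotient k \<longlongrightarrow> L) (at x)"
  shows "(hadamard_quotient k \<longlongrightarrow> x * L + 1 / Gamma_k k (k - x)) (at (x + k))"
proof -
  \<comment> \<open>Any set of integers is closed, so some punctured neighbourhood of
    \<open>x\<close> contains no multiple of \<open>k\<close>, even if \<open>x\<close> is one
    itself.\<close>
  have "open (- ((\<lambda>y. y / k) -` (\<int> - {x / k})))"
    by (intro open_Compl closed_vimage closed_subset_Ints continuous_intros) (use k in auto)
  then have "\<forall>\<^sub>F y in at x. y \<in> - ((\<lambda>y. y / k) -` (\<int> - {x / k}))"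
    by (rule eventually_at_in_open') simp
  moreover have "\<forall>\<^sub>F y in at x. y \<noteq> x"
    by (rule eventually_neq_at_within)
  ultimately have "\<forall>\<^sub>F y in at x. y / k \<notin> \<int>"
    by eventually_elim (use k in auto)
  then have ev: "\<forall>\<^sub>F y in at x. hadamard_quotient k (y + k) =
      y * hadamard_quotient k y + 1 / Gamma_k k (k - y)"
    by eventually_elim (rule hadamard_quotient_plus[OF k])
  have "((\<lambda>y. 1 / Gamma_k k (k - y)) \<longlongrightarrow> 1 / Gamma_k k (k - x)) (at x)"
    unfolding inverse_Gamma_k[OF k] using k
    by (intro isContD continuous_intros) auto
  then have "((\<lambda>y. y * hadamard_quotient k y + 1 / Gamma_k k (k - y)) \<longlongrightarrow>
      x * L + 1 / Gamma_k k (k - x)) (at x)"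
    using L by (intro tendsto_add tendsto_mult tendsto_ident_at)
  then have "((\<lambda>y. hadamard_quotient k (y + k)) \<longlongrightarrow> x * L + 1 / Gamma_k k (k - x)) (at x)"
    using tendsto_cong[OF ev] by simp
  from LIM_offset[OF this, of "- k"] show ?thesis
    by simp
qed

text \<open>\<open>Lim\<close> is meaningful only where a limit exists; this settles existence and
  describes \<open>Hadamard_k\<close> by one limit at all points alike.\<close>

lemma hadamard_quotient_tendsto_Hadamard_k:
  assumes k: "k > 0"
  shows "(hadamard_quotient k \<longlongrightarrow> Hadamard_k k x) (at x)"
proof (cases "\<exists>n::nat. n > 0 \<and> x = real n * k")
  case True
  then obtain n where n: "x = real n * k" by blast
  \<comment> \<open>The induction starts at 0, which is not an exceptional point, so continuity
    provides the base case.\<close>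
  have "\<exists>L. (hadamard_quotient k \<longlongrightarrow> L) (at (real n * k))"
  proof (induction n)
    case 0
    have "isCont (hadamard_quotient k) 0"
      using k by (intro isCont_hadamard_quotient) auto
    then show ?case by (auto simp: isCont_def)
  next
    case (Suc n)
    then obtain L where "(hadamard_quotient k \<longlongrightarrow> L) (at (real n * k))" by blast
    from tendsto_hadamard_quotient_plus[OF k this] show ?case
      by (auto simp: algebra_simps)
  qed
  then obtain L where L: "(hadamard_quotient k \<longlongrightarrow> L) (at x)" using n by blast
  then have "Lim (at x) (hadamard_quotient k) = L"
    by (intro tendsto_Lim) auto
  with True L show ?thesis by (simp add: Hadamard_k_altdef)
next
  case False
  from isCont_hadamard_quotient[OF k False] show ?thesis
    by (simp only: Hadamard_k_altdef False if_False isCont_def)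
qed

theorem theorem4p1:
  fixes k x :: real
  assumes "k > 0"
  shows "Hadamard_k k (x + k) = x * Hadamard_k k x + 1 / Gamma_k k (k - x)"
\<comment> \<open>Both sides are limits of \<open>hadamard_quotient k\<close> at the same point
  \<open>x + k\<close>.\<close>
proof (rule tendsto_unique)
  show "(hadamard_quotient k \<longlongrightarrow> Hadamard_k k (x + k)) (at (x + k))"
    using assms by (rule hadamard_quotient_tendsto_Hadamard_k)
  show "(hadamard_quotient k \<longlongrightarrow> x * Hadamard_k k x + 1 / Gamma_k k (k - x)) (at (x + k))"
    using assms by (intro tendsto_hadamard_quotient_plus hadamard_quotient_tendsto_Hadamard_k)
qed simp

end
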